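(* Let $W:\mathbb{R}^2\to\mathbb{R}$ be a measurable function satisfying $W(q,p)\ge 0$ and $\pi W(q,p)\le 1$ for all $(q,p)$, and $\int_{\mathbb{R}^2} W(q,p)\,dq\,dp=1$, and let $\mu:=2\pi\int_{\mathbb{R}^2}W(q,p)^2\,dq\,dp$. If $\mu\le 4-2\sqrt3$, then $$S[W]\ge 1+\ln\pi .$$
   Context: $S[W]:=-\int_{\mathbb{R}^2} W(q,p)\ln W(q,p)\,dq\,dp$ is the Shannon differential entropy of $W$ (the "Wigner entropy"), with the convention $0\ln 0=0$; since $0\le W\le 1/\pi<1$, it is well defined in $[0,+\infty]$. The quantity $\mu$ is called the purity of $W$. Every Wigner function of a single-mode quantum state that is everywhere non-negative satisfies the hypotheses, but $W$ is not required to be the Wigner function of a quantum state. *)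

theory Defs
  imports "HOL-Analysis.Analysis"
begin

text \<open>
  The entropy is extended-real valued because the integral may diverge (a Bochner integral
  would then silently be 0). It is the integral of the positive part of \<open>- W ln W\<close> minus the
  integral of its negative part; the latter vanishes whenever \<open>0 \<le> W \<le> 1\<close>. The convention
  \<open>0 ln 0 = 0\<close> holds automatically, as \<open>ln 0\<close> is a real number in HOL.
\<close>

definition wigner_entropy :: "(real \<times> real \<Rightarrow> real) \<Rightarrow> ereal" where
  "wigner_entropy W =
     enn2ereal (\<integral>\<^sup>+ x. ennreal (- (W x * ln (W x))) \<partial>lebesgue)
     - enn2ereal (\<integral>\<^sup>+ x. ennreal (W x * ln (W x)) \<partial>lebesgue)"

definition purity :: "(real \<times> real \<Rightarrow> real) \<Rightarrow> real" where
  "purity W = 2 * pi * (\<integral>x. (W x)\<^sup>2 \<partial>lebesgue)"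

end

(* With f = pi W, the tangent to the convex function -ln at 1/e gives -ln f \<ge> 2 - e f.
   Multiplying by W and integrating yields S[W] \<ge> 2 + ln pi - e \<mu> / 2, so \<mu> \<le> 2 / e suffices;
   and 4 - 2 sqrt 3 < 2 / e. *)

theory Submission
  imports Defs
begin

text \<open>\<open>ennreal\<close> sends negative values to 0, so the right-hand side integrates the
  positive part of \<open>g\<close>, which dominates \<open>g\<close>.\<close>

lemma ennreal_integral_le_nn_integral:
  assumes "integrable M g"
  shows "ennreal (integral\<^sup>L M g) \<le> (\<integral>\<^sup>+ x. ennreal (g x) \<partial>M)"
proof -
  have int: "integrable M (\<lambda>x. max 0 (g x))"
    using assms by simp
  have "ennreal (integral\<^sup>L M g) \<le> ennreal (\<integral>x. max 0 (g x) \<partial>M)"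
    by (intro ennreal_leI integral_mono assms int) simp
  also have "\<dots> = (\<integral>\<^sup>+ x. ennreal (max 0 (g x)) \<partial>M)"
    by (intro nn_integral_eq_integral [symmetric] int) simp
  finally show ?thesis
    by (simp add: ennreal_max_0)
qed

text \<open>This is ln t \<le> t - 1 at t = x / c; the point of tangency is
  \<open>c\<close>.\<close>

lemma neg_ln_ge_tangent:
  fixes x c :: real
  assumes "x > 0" "c > 0"
  shows "- ln x \<ge> 1 - ln c - x / c"
  using ln_le_minus_one [of "x / c"] assms by (simp add: ln_div)

lemma wigner_entropy_ge_purity:
  fixes W :: "real \<times> real \<Rightarrow> real"
  assumes meas: "W \<in> borel_measurable lebesgue"
    and nonneg: "\<And>x. W x \<ge> 0"
    and bounded: "\<And>x. pi * W x \<le> 1"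
    and int: "integrable lebesgue W"
    and mass: "(\<integral>x. W x \<partial>lebesgue) = 1"
  shows "wigner_entropy W \<ge> ereal (2 + ln pi - exp 1 * purity W / 2)"
proof -
  \<comment> \<open>An integrable minorant of - W ln W: the tangent bound times \<open>W\<close>.
    Its integral involves only the mass and the purity, while the entropy itself may be
    infinite.\<close>
  define g where "g x = (2 + ln pi) * W x - exp 1 * pi * (W x)\<^sup>2" for x
  have le_1: "W x \<le> 1" for x
    using bounded [of x] nonneg [of x] pi_ge_two mult_right_mono [of 1 pi "W x"] by simp
  \<comment> \<open>Since 0 \<le> W \<le> 1, the square is dominated by \<open>W\<close>.\<close>
  have int_sq: "integrable lebesgue (\<lambda>x. (W x)\<^sup>2)"
  proof (rule Bochner_Integration.integrable_bound [OF int])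
    show "(\<lambda>x. (W x)\<^sup>2) \<in> borel_measurable lebesgue"
      using meas by simp
    show "AE x in lebesgue. norm ((W x)\<^sup>2) \<le> norm (W x)"
      using le_1 nonneg by (intro AE_I2) (simp add: power2_eq_square mult_left_le)
  qed
  have int_g: "integrable lebesgue g"
    unfolding g_def using int int_sq by simp
  have g_le: "g x \<le> - (W x * ln (W x))" for x
  proof (cases "W x = 0")
    case False
    then have pos: "W x > 0"
      using nonneg [of x] by simp
    \<comment> \<open>Tangency at pi W = 1/e means c = 1 / (e pi) for \<open>W\<close> itself, so 1
      - ln c = 2 + ln pi and 1 / c = e pi.\<close>
    have "2 + ln pi - exp 1 * pi * W x \<le> - ln (W x)"
      using neg_ln_ge_tangent [OF pos, of "exp (- 1) / pi"]
      by (simp add: ln_div ln_mult exp_minus field_simps)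
    then have "W x * (2 + ln pi - exp 1 * pi * W x) \<le> W x * (- ln (W x))"
      using pos by (intro mult_left_mono) auto
    then show ?thesis
      by (simp add: g_def power2_eq_square algebra_simps)
  qed (simp add: g_def)
  \<comment> \<open>W \<le> 1 makes W ln W nonpositive, so the subtracted integral is 0 and the
    difference defining the entropy cannot be infinity minus infinity.\<close>
  have neg_part: "(\<integral>\<^sup>+ x. ennreal (W x * ln (W x)) \<partial>lebesgue) = 0"
  proof -
    have "W x * ln (W x) \<le> 0" for x
      using nonneg [of x] le_1 [of x]
      by (cases "W x = 0") (auto intro!: mult_nonneg_nonpos)
    then show ?thesis
      by (simp add: ennreal_neg)
  qed
  have "ennreal (integral\<^sup>L lebesgue g) \<le> (\<integral>\<^sup>+ x. ennreal (g x) \<partial>lebesgue)"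
    by (rule ennreal_integral_le_nn_integral [OF int_g])
  also have "\<dots> \<le> (\<integral>\<^sup>+ x. ennreal (- (W x * ln (W x))) \<partial>lebesgue)"
    by (intro nn_integral_mono ennreal_leI g_le)
  finally have "enn2ereal (ennreal (integral\<^sup>L lebesgue g)) \<le> wigner_entropy W"
    by (simp add: wigner_entropy_def neg_part less_eq_ennreal.rep_eq zero_ennreal.rep_eq)
  \<comment> \<open>\<open>ennreal\<close> clips at 0, which can only increase the value; this
    direction suffices.\<close>
  moreover have "ereal (integral\<^sup>L lebesgue g) \<le> enn2ereal (ennreal (integral\<^sup>L lebesgue g))"
    by (simp add: ennreal.rep_eq)
  moreover have "integral\<^sup>L lebesgue g = 2 + ln pi - exp 1 * purity W / 2"
    unfolding g_def purity_def using int int_sq mass by simp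
  ultimately show ?thesis
    by (metis order_trans)
qed

theorem mainTheorem4:
  fixes W :: "real \<times> real \<Rightarrow> real"
  assumes "W \<in> borel_measurable lebesgue"
    and "\<And>q p. W (q, p) \<ge> 0"
    and "\<And>q p. pi * W (q, p) \<le> 1"
    and "integrable lebesgue W"
    and "(\<integral>x. W x \<partial>lebesgue) = 1"
    and "purity W \<le> 4 - 2 * sqrt 3"
  shows "wigner_entropy W \<ge> ereal (1 + ln pi)"
proof -
  \<comment> \<open>The rational 2/3 separates 4 - 2 sqrt 3 from 2 / e: 5/3 \<le> sqrt 3 gives 4 - 2
    sqrt 3 \<le> 2/3, and e \<le> 3 gives 2/3 \<le> 2 / e.\<close>
  have "sqrt 3 \<ge> 5 / 3"
    by (rule real_le_rsqrt) (simp add: power2_eq_square)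
  then have "purity W \<le> 2 / 3"
    using assms(6) by simp
  then have "exp 1 * purity W \<le> exp 1 * (2 / 3)"
    by (intro mult_left_mono) auto
  also have "\<dots> \<le> 2"
    using exp_le by simp
  finally have "ereal (1 + ln pi) \<le> ereal (2 + ln pi - exp 1 * purity W / 2)"
    by simp
  also have "\<dots> \<le> wigner_entropy W"
    using assms(2,3) by (intro wigner_entropy_ge_purity assms) auto
  finally show ?thesis .
qed

end
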